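(* Let $F(X)=X^3+a_1X^2+a_2X+a_3\in\mathbb{Z}[X]$ be irreducible, let $\alpha$ be a root of $F$, and let $D$ be the discriminant of $F$. (i) Let $I\subset\mathbb{Z}[\alpha]$ be a nonzero ideal that is not divisible by any rational integer (i.e. there is no integer $n\ge 2$ with $I\subseteq n\mathbb{Z}[\alpha]$). Then $I$ has a $\mathbb{Z}$-basis $\{\beta_1,\beta_2,\beta_3\}$ of the form $$\begin{pmatrix}\beta_1\\ \beta_2\\ \beta_3\end{pmatrix}=\begin{pmatrix}1&\mu_1+a_1&\lambda\\ 0&m_1&-\mu_2m_1\\ 0&0&m_1m_2\end{pmatrix}\begin{pmatrix}\alpha^2\\ \alpha\\ 1\end{pmatrix},$$ where $\lambda,\mu_1,\mu_2$ are integers, $m_1,m_2$ are positive integers, and $$F(\mu_1)\equiv 0\pmod{m_1},\qquad F(\mu_2)\equiv 0\pmod{m_2}.$$ Moreover, if $\gcd(m_1,m_2,D)=1$, then $\gcd(m_1,m_2,\mu_1-\mu_2)=1$, and the basis above is unique modulo left multiplication of the coefficient matrix by integral upper-triangular unipotent matrices. (ii) Conversely, if $m_1,m_2$ are positive integers and $\mu_1,\mu_2$ are integers with $F(\mu_1)\equiv0\pmod{m_1}$, $F(\mu_2)\equiv 0\pmod{m_2}$ and $\gcd(m_1,m_2,\mu_1-\mu_2)=1$, then there exists a residue class $\lambda\bmod m_1m_2$, unique for these fixed representatives $\mu_1,\mu_2$, such that the sublattice $I$ of $\mathbb{Z}[\alpha]$ with basis $\{\beta_1,\beta_2,\beta_3\}$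 given by the display above is an ideal of $\mathbb{Z}[\alpha]$. *)

theory Defs
  imports
    "HOL-Algebra.Ideal"
    "HOL-Number_Theory.Cong"
    "Subresultants.Resultant_Prelim"
begin

text \<open>The division is exact, as the leading coefficient of \<open>f\<close> divides the resultant of \<open>f\<close> and \<open>f'\<close>.\<close>

definition discriminant :: "int poly \<Rightarrow> int" where
  "discriminant f =
     (- 1) ^ (degree f * (degree f - 1) div 2) * resultant f (pderiv f) div lead_coeff f"

text \<open>The ring \<open>\<int>[\<alpha>]\<close>, realised inside the ambient ring of \<open>\<alpha>\<close>.\<close>

definition int_adjoin :: "'a::comm_ring_1 \<Rightarrow> 'a ring" where
  "int_adjoin \<alpha> =
     \<lparr>carrier = range (\<lambda>p :: int poly. poly (of_int_poly p) \<alpha>),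
      monoid.mult = (*), one = 1, zero = 0, add = (+)\<rparr>"

definition int_comb :: "(nat \<Rightarrow> int) \<Rightarrow> 'a::comm_ring_1 vec \<Rightarrow> 'a" where
  "int_comb c b = (\<Sum>i<dim_vec b. of_int (c i) * b $ i)"

definition is_int_basis :: "'a::comm_ring_1 vec \<Rightarrow> 'a set \<Rightarrow> bool" where
  "is_int_basis b L \<longleftrightarrow>
     L = range (\<lambda>c. int_comb c b) \<and>
     (\<forall>c. int_comb c b = 0 \<longrightarrow> (\<forall>i<dim_vec b. c i = 0))"

definition basis_mat :: "int \<Rightarrow> int \<Rightarrow> int \<Rightarrow> int \<Rightarrow> int \<Rightarrow> int \<Rightarrow> int mat" where
  "basis_mat a\<^sub>1 m\<^sub>1 m\<^sub>2 \<mu>\<^sub>1 \<mu>\<^sub>2 l = mat_of_rows_list 3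
     [[1, \<mu>\<^sub>1 + a\<^sub>1, l],
      [0, m\<^sub>1,      - \<mu>\<^sub>2 * m\<^sub>1],
      [0, 0,       m\<^sub>1 * m\<^sub>2]]"

definition basis_vec :: "'a::comm_ring_1 \<Rightarrow> int mat \<Rightarrow> 'a vec" where
  "basis_vec \<alpha> M = map_mat of_int M *\<^sub>v vec_of_list [\<alpha>\<^sup>2, \<alpha>, 1]"

definition upper_unipotent :: "nat \<Rightarrow> int mat \<Rightarrow> bool" where
  "upper_unipotent n U \<longleftrightarrow>
     U \<in> carrier_mat n n \<and> upper_triangular U \<and> (\<forall>i<n. U $$ (i, i) = 1)"

end

theory Submission
  imports Defs
begin

text \<open>
  Write \<open>x \<alpha>\<^sup>2 + y \<alpha> + z\<close> as \<open>(x, y, z)\<close>. The Hermite normal form of a nonzero ideal has diagonal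
  \<open>d | e | k\<close>, and closure under multiplication by \<open>\<alpha>\<close> forces \<open>d\<close> to divide every entry, so that
  \<open>d = 1\<close> for a primitive ideal. Closure of the lattice in the displayed form under \<open>\<alpha>\<close> amounts to
  \<open>\<lambda> \<equiv> \<mu>\<^sub>1\<^sup>2 + a\<^sub>1 \<mu>\<^sub>1 + a\<^sub>2 (mod m\<^sub>1)\<close>, \<open>\<lambda> \<equiv> - \<mu>\<^sub>2 (\<mu>\<^sub>1 + \<mu>\<^sub>2 + a\<^sub>1) (mod m\<^sub>2)\<close> and
  \<open>(\<mu>\<^sub>1 - \<mu>\<^sub>2) \<lambda> + a\<^sub>3 + \<mu>\<^sub>2 (\<mu>\<^sub>1\<^sup>2 + a\<^sub>1 \<mu>\<^sub>1 + a\<^sub>2) \<equiv> 0 (mod m\<^sub>1 m\<^sub>2)\<close>. These imply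
  \<open>m\<^sub>i | F(\<mu>\<^sub>i)\<close>. A common divisor of \<open>m\<^sub>1, m\<^sub>2, \<mu>\<^sub>1 - \<mu>\<^sub>2\<close> divides \<open>F(\<mu>\<^sub>1)\<close> and
  \<open>F'(\<mu>\<^sub>1)\<close>, hence the discriminant. Conversely, with \<open>\<lambda> = \<mu>\<^sub>1\<^sup>2 + a\<^sub>1 \<mu>\<^sub>1 + a\<^sub>2 + m\<^sub>1 q\<close> the
  conditions become a consistent system \<open>m\<^sub>1 q \<equiv> - H\<close>, \<open>(\<mu>\<^sub>1 - \<mu>\<^sub>2) q \<equiv> - F(\<mu>\<^sub>1)/m\<^sub>1\<close> modulo
  \<open>m\<^sub>2\<close>, where \<open>(\<mu>\<^sub>1 - \<mu>\<^sub>2) H = F(\<mu>\<^sub>1) - F(\<mu>\<^sub>2)\<close>; it has exactly one solution when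
  \<open>gcd(m\<^sub>1, m\<^sub>2, \<mu>\<^sub>1 - \<mu>\<^sub>2) = 1\<close>.
\<close>

section \<open>Common divisors of polynomial values and the resultant\<close>

text \<open>
  The Sylvester matrix maps the vector of powers of \<open>x\<close> to multiples of \<open>p(x)\<close> and \<open>q(x)\<close>;
  multiplying by the adjugate turns this into the claim.
\<close>

lemma dvd_resultant:
  fixes p q :: "'a::comm_ring_1 poly"
  assumes "g dvd poly p x" "g dvd poly q x" and pos: "degree p + degree q > 0"
  shows "g dvd resultant p q"
proof -
  define m n where mn: "m = degree p" "n = degree q"
  define S where "S = sylvester_mat p q"
  \<comment> \<open>The powers of \<open>x\<close> descend so as to match the order of the
    coefficients in a row of the Sylvester matrix.\<close>
  define v where "v = vec (m + n) (\<lambda>j. x ^ (m + n - 1 - j))"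
  have S: "S \<in> carrier_mat (m + n) (m + n)"
    unfolding S_def mn by (rule sylvester_carrier_mat)
  have v: "v \<in> carrier_vec (m + n)"
    by (simp add: v_def)
  \<comment> \<open>A row holding the coefficients of \<open>r\<close> from column \<open>i\<close>
    on, paired with \<open>v\<close>, gives a power of \<open>x\<close> times the value of
    \<open>r\<close> at \<open>x\<close>. The rows of \<open>p\<close> and of \<open>q\<close> are
    both of this kind.\<close>
  have shift: "(\<Sum>j<m + n. (if i \<le> j \<and> j - i \<le> degree r then coeff r (degree r + i - j) else 0) * x ^ (m + n - 1 - j))
      = x ^ (m + n - 1 - (degree r + i)) * poly r x"
    if i: "i + degree r < m + n" for i r
  proof -
    have "(\<Sum>j<m + n. (if i \<le> j \<and> j - i \<le> degree r then coeff r (degree r + i - j) else 0) * x ^ (m + n - 1 - j))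
        = (\<Sum>j\<in>{i..i + degree r}. coeff r (degree r + i - j) * x ^ (m + n - 1 - j))"
      using i by (intro sum.mono_neutral_cong_right) auto
    also have "\<dots> = (\<Sum>k\<le>degree r. coeff r k * x ^ (m + n - 1 - (degree r + i) + k))"
      using i by (intro sum.reindex_bij_witness[where i = "\<lambda>k. degree r + i - k" and j = "\<lambda>j. degree r + i - j"])
        (auto intro!: arg_cong[where f = "\<lambda>k. x ^ k"])
    also have "\<dots> = x ^ (m + n - 1 - (degree r + i)) * poly r x"
      by (simp add: poly_altdef sum_distrib_left power_add mult_ac)
    finally show ?thesis .
  qed
  have row: "g dvd (S *\<^sub>v v) $ i" if i: "i < m + n" for i
  proof -
    have eq: "(S *\<^sub>v v) $ i = (\<Sum>j<m + n. S $$ (i, j) * x ^ (m + n - 1 - j))"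
      using i S by (simp add: v_def scalar_prod_def atLeast0LessThan)
    show ?thesis
    proof (cases "i < n")
      case True
      have "(S *\<^sub>v v) $ i = x ^ (m + n - 1 - (m + i)) * poly p x"
        unfolding eq using True i shift[of i p]
        by (simp add: S_def sylvester_index_mat mn)
      then show ?thesis
        using assms(1) by simp
    next
      case False
      have "(S *\<^sub>v v) $ i = (\<Sum>j<m + n. (if i - n \<le> j \<and> j - (i - n) \<le> n then coeff q (n + (i - n) - j) else 0) * x ^ (m + n - 1 - j))"
        unfolding eq using False i
        by (intro sum.cong) (auto simp: S_def sylvester_index_mat mn)
      also have "\<dots> = x ^ (m + n - 1 - (n + (i - n))) * poly q x"
        using shift[of "i - n" q] False i unfolding mn by linarith
      finally show ?thesis
        using assms(2) by simp
    qed
  qed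
  \<comment> \<open>The last index is chosen because the entry of \<open>v\<close> there is
    \<open>x ^ 0 = 1\<close>, so that the determinant appears without a power of
    \<open>x\<close>.\<close>
  define k where "k = m + n - 1"
  have k: "k < m + n"
    using pos by (simp add: k_def mn)
  note A = adj_mat[OF S]
  have "adj_mat S *\<^sub>v (S *\<^sub>v v) = (det S \<cdot>\<^sub>m 1\<^sub>m (m + n)) *\<^sub>v v"
    using A S v by (metis assoc_mult_mat_vec)
  then have "(adj_mat S *\<^sub>v (S *\<^sub>v v)) $ k = det S * v $ k"
    using k v by (simp add: scalar_prod_def if_distrib if_distribR sum.delta cong: if_cong)
  also have "\<dots> = resultant p q"
    using k by (simp add: v_def k_def resultant_def S_def)
  also have "(adj_mat S *\<^sub>v (S *\<^sub>v v)) $ k = (\<Sum>i<m + n. adj_mat S $$ (k, i) * (S *\<^sub>v v) $ i)"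
    using k S A(1) by (simp add: scalar_prod_def atLeast0LessThan)
  finally have "resultant p q = (\<Sum>i<m + n. adj_mat S $$ (k, i) * (S *\<^sub>v v) $ i)" ..
  then show ?thesis
    using row by (auto intro!: dvd_sum dvd_mult)
qed

section \<open>Subgroups of the integers and integral Bezout relations\<close>

text \<open>Division with remainder by the least positive element: the remainder lies in
  \<open>S\<close> again and is smaller, hence zero. This supplies the diagonal of the Hermite
  normal form.\<close>

lemma int_subgroup_generator:
  fixes S :: "int set"
  assumes "0 \<in> S" and diff: "\<And>x y. x \<in> S \<Longrightarrow> y \<in> S \<Longrightarrow> x - y \<in> S"
  obtains d where "d \<ge> 0" "d \<in> S" "\<And>x. x \<in> S \<Longrightarrow> d dvd x"
proof (cases "S = {0}")
  case True
  then show ?thesis using that[of 0] by auto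
next
  case False
  then obtain y where y: "y \<in> S" "y \<noteq> 0"
    using assms(1) by blast
  have neg: "- x \<in> S" if "x \<in> S" for x
    using diff[OF assms(1) that] by simp
  have add: "x + y \<in> S" if "x \<in> S" "y \<in> S" for x y
    using diff[OF that(1) neg[OF that(2)]] by simp
  have "\<exists>n::nat. n > 0 \<and> int n \<in> S"
    using y neg[of y] by (intro exI[of _ "nat \<bar>y\<bar>"]) (auto simp: abs_if)
  then obtain n :: nat where n: "n > 0" "int n \<in> S"
      and least: "\<And>k. k > 0 \<Longrightarrow> int k \<in> S \<Longrightarrow> n \<le> k"
    using LeastI_ex[of "\<lambda>n. n > 0 \<and> int n \<in> S"] Least_le[of "\<lambda>n. n > 0 \<and> int n \<in> S"]
    by blast
  have nat_mult: "int k * int n \<in> S" for k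
    by (induction k) (use assms(1) n add in \<open>auto simp: algebra_simps\<close>)
  have mult: "k * int n \<in> S" for k
    by (cases k rule: int_cases2) (use nat_mult neg in auto)
  have "int n dvd x" if "x \<in> S" for x
  proof -
    have eq: "x mod int n = x - x div int n * int n"
      by (simp add: minus_div_mult_eq_mod)
    have "x mod int n \<in> S"
      unfolding eq by (rule diff[OF that mult])
    moreover have "0 \<le> x mod int n" "x mod int n < int n"
      using n by simp_all
    ultimately have "x mod int n = 0"
      using least[of "nat (x mod int n)"] by (cases "x mod int n = 0") auto
    then show ?thesis
      by (rule mod_0_imp_dvd)
  qed
  then show ?thesis using that[of "int n"] n by simp
qed

text \<open>Euclid's algorithm with pseudo-division, which stays inside the coefficient ring; the
  price is a nonzero constant \<open>c\<close> in place of 1. Irreducibility of \<open>F\<close>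
  keeps every remainder nonzero until the degree reaches 0.\<close>

lemma bezout_irreducible:
  fixes F p :: "'a::{factorial_ring_gcd,semiring_gcd_mult_normalize} poly"
  assumes "irreducible F" "p \<noteq> 0" "degree p < degree F"
  shows "\<exists>s t c. c \<noteq> 0 \<and> s * p + t * F = [:c:]"
  using assms(2,3)
proof (induction "degree p" arbitrary: p rule: less_induct)
  case less
  show ?case
  proof (cases "degree p = 0")
    case True
    then obtain c where "p = [:c:]"
      by (rule degree_eq_zeroE)
    then show ?thesis
      using less.prems by (intro exI[of _ 1] exI[of _ 0] exI[of _ c]) simp
  next
    case False
    define r where "r = pseudo_mod F p"
    obtain a q where aq: "a \<noteq> 0" "smult a F = p * q + r" and deg: "r = 0 \<or> degree r < degree p"
      using pseudo_mod[OF less.prems(1), of F] unfolding r_def by blast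
    \<comment> \<open>Otherwise \<open>F\<close>, being prime, divides \<open>p\<close> or
      \<open>q\<close>. Both have degree smaller than \<open>F\<close>: the first by hypothesis, the
      second because \<open>p\<close> is not constant.\<close>
    have "r \<noteq> 0"
    proof
      assume "r = 0"
      have "prime_elem F"
        using assms(1) by (rule irreducible_imp_prime_elem)
      moreover have "F dvd p * q"
        using aq \<open>r = 0\<close> by (metis add.right_neutral dvd_refl dvd_smult)
      ultimately consider "F dvd p" | "F dvd q"
        using prime_elem_dvd_multD by blast
      then show False
      proof cases
        case 1
        then show False using less.prems dvd_imp_degree_le[of F p] by simp
      next
        case 2
        have "F \<noteq> 0" using assms(1) by auto
        then have "q \<noteq> 0"
          using aq \<open>r = 0\<close> by auto
        have "degree F = degree p + degree q"
          using aq \<open>r = 0\<close> less.prems \<open>q \<noteq> 0\<close> degree_mult_eq[of p q] by (metis add.right_neutral degree_smult_eq)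
        then show False
          using dvd_imp_degree_le[OF 2 \<open>q \<noteq> 0\<close>] False by simp
      qed
    qed
    then obtain s t c where c: "c \<noteq> 0" "s * r + t * F = [:c:]"
      using less.hyps[of r] deg less.prems by auto
    \<comment> \<open>The remainder \<open>r\<close> is replaced by \<open>smult a F - p * q\<close>
      in the relation obtained for it.\<close>
    have "(- s * q) * p + (t + smult a s) * F = t * F + s * (smult a F - p * q)"
      by (simp add: algebra_simps)
    also have "\<dots> = s * r + t * F"
      by (simp add: aq)
    finally have "(- s * q) * p + (t + smult a s) * F = s * r + t * F" .
    then show ?thesis using c by metis
  qed
qed

section \<open>Coordinates with respect to \<alpha> squared, \<alpha>, 1\<close>

locale cubic_root =
  fixes a\<^sub>1 a\<^sub>2 a\<^sub>3 :: int and F :: "int poly" and \<alpha> :: "'a::field_char_0"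
  assumes F_eq: "F = [:a\<^sub>3, a\<^sub>2, a\<^sub>1, 1:]"
    and irred: "irreducible F"
    and root: "poly (of_int_poly F) \<alpha> = 0"
begin

definition elt :: "int \<Rightarrow> int \<Rightarrow> int \<Rightarrow> 'a" where
  "elt x y z = of_int x * \<alpha>\<^sup>2 + of_int y * \<alpha> + of_int z"

abbreviation R :: "'a ring" where
  "R \<equiv> int_adjoin \<alpha>"

lemma poly_F: "poly F x = x ^ 3 + a\<^sub>1 * x ^ 2 + a\<^sub>2 * x + a\<^sub>3"
  by (simp add: F_eq algebra_simps power2_eq_square power3_eq_cube)

lemma alpha_cubed: "\<alpha> ^ 3 = - (of_int a\<^sub>1 * \<alpha>\<^sup>2 + of_int a\<^sub>2 * \<alpha> + of_int a\<^sub>3)"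
  using root by (simp add: F_eq algebra_simps power2_eq_square power3_eq_cube eq_neg_iff_add_eq_0)

lemma elt_add: "elt x y z + elt x' y' z' = elt (x + x') (y + y') (z + z')"
  and elt_diff: "elt x y z - elt x' y' z' = elt (x - x') (y - y') (z - z')"
  and elt_smult: "of_int n * elt x y z = elt (n * x) (n * y) (n * z)"
  by (simp_all add: elt_def algebra_simps)

lemma elt_alpha: "\<alpha> * elt x y z = elt (y - a\<^sub>1 * x) (z - a\<^sub>2 * x) (- a\<^sub>3 * x)"
proof -
  have "\<alpha> * elt x y z = of_int x * \<alpha> ^ 3 + of_int y * \<alpha>\<^sup>2 + of_int z * \<alpha>"
    by (simp add: elt_def algebra_simps power2_eq_square power3_eq_cube)
  then show ?thesis
    by (simp add: alpha_cubed elt_def algebra_simps)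
qed

text \<open>Evaluating a Bezout relation between \<open>p\<close> and \<open>F\<close> at \<alpha>
  removes the multiple of \<open>F\<close>. This yields both the independence of the powers of
  \<alpha> and nonzero integers in ideals.\<close>

lemma int_relation:
  assumes "p \<noteq> 0" "degree p < 3"
  obtains s c where "c \<noteq> 0" "poly (of_int_poly s) \<alpha> * poly (of_int_poly p) \<alpha> = of_int c"
proof -
  have "degree F = 3" by (simp add: F_eq)
  then obtain s t c where c: "c \<noteq> 0" "s * p + t * F = [:c:]"
    using bezout_irreducible[OF irred assms(1)] assms(2) by auto
  have "poly (of_int_poly (s * p + t * F)) \<alpha> = of_int c"
    unfolding c by (simp add: of_int_hom.map_poly_pCons_hom)
  then have "poly (of_int_poly s) \<alpha> * poly (of_int_poly p) \<alpha> = of_int c"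
    using root by (simp add: hom_distribs)
  then show ?thesis
    using that c(1) by blast
qed

lemma elt_as_poly: "elt x y z = poly (of_int_poly [:z, y, x:]) \<alpha>"
  by (simp add: elt_def of_int_hom.map_poly_pCons_hom algebra_simps power2_eq_square)

text \<open>The assumption concerns the coordinates and not the element, so that the relation can be
  used to prove linear independence.\<close>

lemma elt_relation:
  assumes "(x, y, z) \<noteq> (0, 0, 0)"
  obtains s c where "c \<noteq> 0" "poly (of_int_poly s) \<alpha> * elt x y z = of_int c"
proof (rule int_relation[of "[:z, y, x:]"])
  show "[:z, y, x:] \<noteq> 0" using assms by auto
qed (use that in \<open>auto simp only: elt_as_poly\<close>, simp)

lemma elt_eq_0_iff: "elt x y z = 0 \<longleftrightarrow> x = 0 \<and> y = 0 \<and> z = 0"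
proof
  assume "elt x y z = 0"
  then show "x = 0 \<and> y = 0 \<and> z = 0"
    using elt_relation[of x y z] by (metis mult_zero_right of_int_eq_0_iff prod.inject)
qed (simp add: elt_def)

lemma elt_eq_iff: "elt x y z = elt x' y' z' \<longleftrightarrow> x = x' \<and> y = y' \<and> z = z'"
  using elt_eq_0_iff[of "x - x'" "y - y'" "z - z'"] elt_diff[of x y z x' y' z'] by auto

lemma poly_alpha_elt: "\<exists>x y z. poly (of_int_poly p) \<alpha> = elt x y z"
proof (induction p)
  case 0
  show ?case by (intro exI[of _ 0]) (simp add: elt_def)
next
  case (pCons a p)
  then obtain x y z where xyz: "poly (of_int_poly p) \<alpha> = elt x y z" by blast
  have "poly (of_int_poly (pCons a p)) \<alpha> = elt 0 0 a + \<alpha> * elt x y z"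
    using xyz by (simp add: elt_def of_int_hom.map_poly_pCons_hom)
  also have "\<dots> = elt (y - a\<^sub>1 * x) (z - a\<^sub>2 * x) (a - a\<^sub>3 * x)"
    unfolding elt_alpha elt_add by simp
  finally show ?case by blast
qed

section \<open>The ring generated by \<alpha> and its ideals\<close>

lemma carrier_R: "carrier R = {elt x y z | x y z. True}"
  using poly_alpha_elt elt_as_poly by (fastforce simp: int_adjoin_def)

lemma R_simps: "x \<otimes>\<^bsub>R\<^esub> y = x * y" "x \<oplus>\<^bsub>R\<^esub> y = x + y" "\<one>\<^bsub>R\<^esub> = 1" "\<zero>\<^bsub>R\<^esub> = 0"
  by (simp_all add: int_adjoin_def)

lemma poly_in_R: "poly (of_int_poly p) \<alpha> \<in> carrier R"
  by (simp add: int_adjoin_def)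

lemma ring_R: "ring R"
proof (rule ringI)
  have closed: "x + y \<in> carrier R" "x * y \<in> carrier R" "- x \<in> carrier R"
    if xy: "x \<in> carrier R" "y \<in> carrier R" for x y
  proof -
    obtain p q where pq: "x = poly (of_int_poly p) \<alpha>" "y = poly (of_int_poly q) \<alpha>"
      using xy by (auto simp: int_adjoin_def)
    show "x + y \<in> carrier R" "x * y \<in> carrier R" "- x \<in> carrier R"
      using poly_in_R[of "p + q"] poly_in_R[of "p * q"] poly_in_R[of "- p"] pq
      by (simp_all add: of_int_poly_hom.hom_add of_int_poly_hom.hom_mult of_int_poly_hom.hom_uminus)
  qed
  have one: "1 \<in> carrier R" "0 \<in> carrier R"
    using poly_in_R[of 1] poly_in_R[of 0] by simp_all
  show "abelian_group R"
    by (rule abelian_groupI) (use closed one in \<open>auto simp: R_simps intro: bexI[of _ "- _"]\<close>)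
  show "monoid R"
    by (rule monoidI) (use closed one in \<open>auto simp: R_simps\<close>)
qed (simp_all add: R_simps algebra_simps)

lemma a_inv_R: "x \<in> carrier R \<Longrightarrow> \<ominus>\<^bsub>R\<^esub> x = - x"
proof -
  assume x: "x \<in> carrier R"
  interpret ring R by (rule ring_R)
  have "x + (\<ominus>\<^bsub>R\<^esub> x) = 0"
    using r_neg[OF x] by (simp add: R_simps)
  then show ?thesis by (simp add: add_eq_0_iff)
qed

text \<open>Since \<alpha> generates the ring, a subgroup closed under multiplication by \<alpha>
  absorbs all integer polynomials in \<alpha>: integer multiples are repeated sums, and Horner's
  scheme does the rest.\<close>

lemma ideal_R_iff:
  "ideal I R \<longleftrightarrow>
     I \<subseteq> carrier R \<and> 0 \<in> I \<and> (\<forall>x\<in>I. \<forall>y\<in>I. x - y \<in> I) \<and> (\<forall>x\<in>I. \<alpha> * x \<in> I)"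
    (is "?L \<longleftrightarrow> ?C")
proof
  assume L: ?L
  interpret ideal I R by (rule L)
  have "x - y \<in> I" if "x \<in> I" "y \<in> I" for x y
    using additive_subgroup.a_closed[OF is_additive_subgroup that(1)
        additive_subgroup.a_inv_closed[OF is_additive_subgroup that(2)]] a_inv_R[of y] a_subset that
    by (auto simp: R_simps)
  moreover have "\<alpha> * x \<in> I" if "x \<in> I" for x
    using I_l_closed[OF that, of \<alpha>] poly_in_R[of "[:0, 1:]"] by (simp add: R_simps)
  ultimately show ?C
    using a_subset additive_subgroup.zero_closed[OF is_additive_subgroup] by (auto simp: R_simps)
next
  assume C: ?C
  have neg: "- x \<in> I" if "x \<in> I" for x
    using C that by (metis diff_0)
  have add: "x + y \<in> I" if "x \<in> I" "y \<in> I" for x y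
    using C that neg by (metis diff_minus_eq_add)
  have nat_mult: "of_nat n * x \<in> I" if "x \<in> I" for n x
    by (induction n) (use C that add in \<open>auto simp: algebra_simps\<close>)
  have int_mult: "of_int n * x \<in> I" if "x \<in> I" for n x
    by (cases n rule: int_cases2) (use nat_mult[OF that] neg in auto)
  have poly_mult: "poly (of_int_poly p) \<alpha> * x \<in> I" if "x \<in> I" for p x
  proof (induction p)
    case (pCons a p)
    have "poly (of_int_poly (pCons a p)) \<alpha> * x = of_int a * x + \<alpha> * (poly (of_int_poly p) \<alpha> * x)"
      by (simp add: of_int_hom.map_poly_pCons_hom algebra_simps)
    then show ?case
      using pCons C that int_mult add by auto
  qed (use C in simp)
  have mult: "r * x \<in> I" if "x \<in> I" "r \<in> carrier R" for r x
    using that poly_mult by (auto simp: int_adjoin_def)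
  show ?L
  proof (rule idealI)
    interpret ring R by (rule ring_R)
    show "subgroup I (add_monoid R)"
    proof (rule add.subgroupI)
      show "\<ominus>\<^bsub>R\<^esub> x \<in> I" if "x \<in> I" for x
        using a_inv_R[of x] neg C that by auto
    qed (use C add in \<open>auto simp: R_simps\<close>)
  qed (use ring_R mult in \<open>auto simp: R_simps mult.commute\<close>)
qed

text \<open>A nonzero element has a multiple in the ideal that is a nonzero integer. It makes the
  last diagonal entry of the normal form nonzero.\<close>

lemma ideal_meets_int:
  assumes "ideal I R" "I \<noteq> {0}"
  obtains c where "c \<noteq> 0" "of_int c \<in> I"
proof -
  interpret ideal I R by (rule assms(1))
  obtain u where u: "u \<in> I" "u \<noteq> 0"
    using assms(2) additive_subgroup.zero_closed[OF is_additive_subgroup] by (auto simp: R_simps)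
  obtain x y z where xyz: "u = elt x y z"
    using u(1) a_subset carrier_R by blast
  have "(x, y, z) \<noteq> (0, 0, 0)"
    using u(2) xyz elt_eq_0_iff by auto
  then obtain s c where c: "c \<noteq> 0" "poly (of_int_poly s) \<alpha> * elt x y z = of_int c"
    by (rule elt_relation)
  then show ?thesis
    using that[of c] I_l_closed[OF u(1) poly_in_R[of s]] xyz by (simp add: R_simps)
qed

section \<open>Lattices in the displayed form and closure under \<alpha>\<close>

abbreviation basis :: "int \<Rightarrow> int \<Rightarrow> int \<Rightarrow> int \<Rightarrow> int \<Rightarrow> int mat" where
  "basis \<equiv> basis_mat a\<^sub>1"

definition lat :: "int \<Rightarrow> int \<Rightarrow> int \<Rightarrow> int \<Rightarrow> int \<Rightarrow> 'a set" where
  "lat m\<^sub>1 m\<^sub>2 \<mu>\<^sub>1 \<mu>\<^sub>2 l =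
     {elt x (x * (\<mu>\<^sub>1 + a\<^sub>1) + y * m\<^sub>1) (x * l - y * \<mu>\<^sub>2 * m\<^sub>1 + z * (m\<^sub>1 * m\<^sub>2)) | x y z. True}"

lemma int_comb_basis_vec:
  "int_comb c (basis_vec \<alpha> (basis m\<^sub>1 m\<^sub>2 \<mu>\<^sub>1 \<mu>\<^sub>2 l)) =
     elt (c 0) (c 0 * (\<mu>\<^sub>1 + a\<^sub>1) + c 1 * m\<^sub>1) (c 0 * l - c 1 * \<mu>\<^sub>2 * m\<^sub>1 + c 2 * (m\<^sub>1 * m\<^sub>2))"
  by (simp add: int_comb_def basis_vec_def basis_mat_def mat_of_rows_list_def scalar_prod_def
      numeral_3_eq_3 numeral_2_eq_2 elt_def algebra_simps vec_of_list_index)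

lemma dim_basis_vec: "dim_vec (basis_vec \<alpha> (basis m\<^sub>1 m\<^sub>2 \<mu>\<^sub>1 \<mu>\<^sub>2 l)) = 3"
  by (simp add: basis_vec_def basis_mat_def mat_of_rows_list_def)

text \<open>The matrix is triangular with nonzero diagonal, so its rows are independent and only the
  span has to be compared.\<close>

lemma is_int_basis_iff:
  assumes "m\<^sub>1 > 0" "m\<^sub>2 > 0"
  shows "is_int_basis (basis_vec \<alpha> (basis m\<^sub>1 m\<^sub>2 \<mu>\<^sub>1 \<mu>\<^sub>2 l)) I \<longleftrightarrow> I = lat m\<^sub>1 m\<^sub>2 \<mu>\<^sub>1 \<mu>\<^sub>2 l"
proof -
  have "range (\<lambda>c. int_comb c (basis_vec \<alpha> (basis m\<^sub>1 m\<^sub>2 \<mu>\<^sub>1 \<mu>\<^sub>2 l))) = lat m\<^sub>1 m\<^sub>2 \<mu>\<^sub>1 \<mu>\<^sub>2 l"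
  proof
    show "lat m\<^sub>1 m\<^sub>2 \<mu>\<^sub>1 \<mu>\<^sub>2 l \<subseteq> range (\<lambda>c. int_comb c (basis_vec \<alpha> (basis m\<^sub>1 m\<^sub>2 \<mu>\<^sub>1 \<mu>\<^sub>2 l)))"
    proof
      fix u assume "u \<in> lat m\<^sub>1 m\<^sub>2 \<mu>\<^sub>1 \<mu>\<^sub>2 l"
      then obtain x y z where
        "u = elt x (x * (\<mu>\<^sub>1 + a\<^sub>1) + y * m\<^sub>1) (x * l - y * \<mu>\<^sub>2 * m\<^sub>1 + z * (m\<^sub>1 * m\<^sub>2))"
        unfolding lat_def by blast
      then have "u = int_comb (\<lambda>i. if i = 0 then x else if i = 1 then y else z)
          (basis_vec \<alpha> (basis m\<^sub>1 m\<^sub>2 \<mu>\<^sub>1 \<mu>\<^sub>2 l))"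
        by (simp add: int_comb_basis_vec)
      then show "u \<in> range (\<lambda>c. int_comb c (basis_vec \<alpha> (basis m\<^sub>1 m\<^sub>2 \<mu>\<^sub>1 \<mu>\<^sub>2 l)))"
        by blast
    qed
  qed (auto simp: lat_def int_comb_basis_vec)
  moreover have "c i = 0"
    if "int_comb c (basis_vec \<alpha> (basis m\<^sub>1 m\<^sub>2 \<mu>\<^sub>1 \<mu>\<^sub>2 l)) = 0" "i < 3" for c i
  proof -
    have "i = 0 \<or> i = 1 \<or> i = 2"
      using that(2) by auto
    then show ?thesis
      using that(1) assms by (auto simp: int_comb_basis_vec elt_eq_0_iff)
  qed
  ultimately show ?thesis
    unfolding is_int_basis_def dim_basis_vec by auto
qed

lemma elt_in_lat_iff:
  "elt x y z \<in> lat m\<^sub>1 m\<^sub>2 \<mu>\<^sub>1 \<mu>\<^sub>2 l \<longleftrightarrow>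
     (\<exists>p q. y = x * (\<mu>\<^sub>1 + a\<^sub>1) + p * m\<^sub>1 \<and> z = x * l - p * \<mu>\<^sub>2 * m\<^sub>1 + q * (m\<^sub>1 * m\<^sub>2))"
  unfolding lat_def by (auto simp: elt_eq_iff)

lemma lat_diff:
  assumes "u \<in> lat m\<^sub>1 m\<^sub>2 \<mu>\<^sub>1 \<mu>\<^sub>2 l" "v \<in> lat m\<^sub>1 m\<^sub>2 \<mu>\<^sub>1 \<mu>\<^sub>2 l"
  shows "u - v \<in> lat m\<^sub>1 m\<^sub>2 \<mu>\<^sub>1 \<mu>\<^sub>2 l"
proof -
  obtain x y z x' y' z' where uv:
    "u = elt x (x * (\<mu>\<^sub>1 + a\<^sub>1) + y * m\<^sub>1) (x * l - y * \<mu>\<^sub>2 * m\<^sub>1 + z * (m\<^sub>1 * m\<^sub>2))"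
    "v = elt x' (x' * (\<mu>\<^sub>1 + a\<^sub>1) + y' * m\<^sub>1) (x' * l - y' * \<mu>\<^sub>2 * m\<^sub>1 + z' * (m\<^sub>1 * m\<^sub>2))"
    using assms unfolding lat_def by blast
  show ?thesis
    unfolding uv elt_diff elt_in_lat_iff
    by (rule exI[of _ "y - y'"], rule exI[of _ "z - z'"]) (simp add: algebra_simps)
qed

text \<open>It suffices to multiply the basis by \<alpha>. The first vector gives the first and
  third conditions, the second vector gives the second condition, and the third vector always stays
  in the lattice.\<close>

lemma ideal_lat_iff:
  assumes "m\<^sub>1 > 0" "m\<^sub>2 > 0"
  shows "ideal (lat m\<^sub>1 m\<^sub>2 \<mu>\<^sub>1 \<mu>\<^sub>2 l) R \<longleftrightarrow>
     m\<^sub>1 dvd l - (\<mu>\<^sub>1\<^sup>2 + a\<^sub>1 * \<mu>\<^sub>1 + a\<^sub>2) \<and>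
     m\<^sub>2 dvd l + \<mu>\<^sub>2 * (\<mu>\<^sub>1 + \<mu>\<^sub>2 + a\<^sub>1) \<and>
     m\<^sub>1 * m\<^sub>2 dvd (\<mu>\<^sub>1 - \<mu>\<^sub>2) * l + a\<^sub>3 + \<mu>\<^sub>2 * (\<mu>\<^sub>1\<^sup>2 + a\<^sub>1 * \<mu>\<^sub>1 + a\<^sub>2)"
    (is "ideal ?L R \<longleftrightarrow> ?A \<and> ?B \<and> ?C")
proof
  assume "ideal ?L R"
  then have mult: "\<alpha> * u \<in> ?L" if "u \<in> ?L" for u
    using that by (simp add: ideal_R_iff)
  have "elt 1 (\<mu>\<^sub>1 + a\<^sub>1) l \<in> ?L"
    by (auto simp: elt_in_lat_iff intro!: exI[of _ 0])
  then have "elt \<mu>\<^sub>1 (l - a\<^sub>2) (- a\<^sub>3) \<in> ?L"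
    using mult by (fastforce simp: elt_alpha)
  then obtain p q where pq: "l - a\<^sub>2 = \<mu>\<^sub>1 * (\<mu>\<^sub>1 + a\<^sub>1) + p * m\<^sub>1"
      "- a\<^sub>3 = \<mu>\<^sub>1 * l - p * \<mu>\<^sub>2 * m\<^sub>1 + q * (m\<^sub>1 * m\<^sub>2)"
    unfolding elt_in_lat_iff by blast
  have eq1: "l - (\<mu>\<^sub>1\<^sup>2 + a\<^sub>1 * \<mu>\<^sub>1 + a\<^sub>2) = p * m\<^sub>1"
    using pq(1) by (simp add: algebra_simps power2_eq_square)
  have eq2: "(\<mu>\<^sub>1 - \<mu>\<^sub>2) * l + a\<^sub>3 + \<mu>\<^sub>2 * (\<mu>\<^sub>1\<^sup>2 + a\<^sub>1 * \<mu>\<^sub>1 + a\<^sub>2) = - q * (m\<^sub>1 * m\<^sub>2)"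
  proof -
    have "a\<^sub>3 = \<mu>\<^sub>2 * (p * m\<^sub>1) - \<mu>\<^sub>1 * l - q * (m\<^sub>1 * m\<^sub>2)"
      using pq(2) by (simp add: algebra_simps)
    then show ?thesis
      unfolding eq1[symmetric] by (simp add: algebra_simps)
  qed
  have "elt 0 m\<^sub>1 (- \<mu>\<^sub>2 * m\<^sub>1) \<in> ?L"
    unfolding elt_in_lat_iff by (rule exI[of _ 1], rule exI[of _ 0]) simp
  then have "elt m\<^sub>1 (- \<mu>\<^sub>2 * m\<^sub>1) 0 \<in> ?L"
    using mult by (fastforce simp: elt_alpha)
  then obtain r s where rs: "- \<mu>\<^sub>2 * m\<^sub>1 = m\<^sub>1 * (\<mu>\<^sub>1 + a\<^sub>1) + r * m\<^sub>1"
      "0 = m\<^sub>1 * l - r * \<mu>\<^sub>2 * m\<^sub>1 + s * (m\<^sub>1 * m\<^sub>2)"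
    unfolding elt_in_lat_iff by blast
  have "m\<^sub>1 * (\<mu>\<^sub>1 + \<mu>\<^sub>2 + a\<^sub>1 + r) = 0"
    using rs(1) by (simp add: algebra_simps)
  then have r: "r = - (\<mu>\<^sub>1 + \<mu>\<^sub>2 + a\<^sub>1)"
    using assms by auto
  have "m\<^sub>1 * (l + \<mu>\<^sub>2 * (\<mu>\<^sub>1 + \<mu>\<^sub>2 + a\<^sub>1) + s * m\<^sub>2) = 0"
    using rs(2) unfolding r by (simp add: algebra_simps)
  then have eq3: "l + \<mu>\<^sub>2 * (\<mu>\<^sub>1 + \<mu>\<^sub>2 + a\<^sub>1) = - s * m\<^sub>2"
    using assms by auto
  show "?A \<and> ?B \<and> ?C"
    unfolding eq1 eq2 eq3 by simp
next
  assume "?A \<and> ?B \<and> ?C"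
  then obtain p q s where
    p: "l - (\<mu>\<^sub>1\<^sup>2 + a\<^sub>1 * \<mu>\<^sub>1 + a\<^sub>2) = m\<^sub>1 * p" and
    s: "l + \<mu>\<^sub>2 * (\<mu>\<^sub>1 + \<mu>\<^sub>2 + a\<^sub>1) = m\<^sub>2 * s" and
    q: "(\<mu>\<^sub>1 - \<mu>\<^sub>2) * l + a\<^sub>3 + \<mu>\<^sub>2 * (\<mu>\<^sub>1\<^sup>2 + a\<^sub>1 * \<mu>\<^sub>1 + a\<^sub>2) = m\<^sub>1 * m\<^sub>2 * q"
    unfolding dvd_def by blast
  have "\<alpha> * u \<in> ?L" if "u \<in> ?L" for u
  proof -
    obtain x y z where
      u: "u = elt x (x * (\<mu>\<^sub>1 + a\<^sub>1) + y * m\<^sub>1) (x * l - y * \<mu>\<^sub>2 * m\<^sub>1 + z * (m\<^sub>1 * m\<^sub>2))"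
      using \<open>u \<in> ?L\<close> unfolding lat_def by blast
    \<comment> \<open>Coordinates of \<open>\<alpha> * u\<close> in the basis
      \<open>b1, b2, b3\<close>, from
      \<open>\<alpha> * b1 = \<mu>\<^sub>1 * b1 + p * b2 - q * b3\<close>, \<open>\<alpha> * b2 =
      m\<^sub>1 * b1 - (\<mu>\<^sub>1 + \<mu>\<^sub>2 + a\<^sub>1) * b2 - s * b3\<close> and
      \<open>\<alpha> * b3 = m\<^sub>2 * b2 + \<mu>\<^sub>2 * b3\<close>.\<close>
    define X Y Z where "X = x * \<mu>\<^sub>1 + y * m\<^sub>1"
      and "Y = x * p - y * (\<mu>\<^sub>1 + \<mu>\<^sub>2 + a\<^sub>1) + z * m\<^sub>2"
      and "Z = - x * q - y * s + z * \<mu>\<^sub>2"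
    have 1: "x * (\<mu>\<^sub>1 + a\<^sub>1) + y * m\<^sub>1 - a\<^sub>1 * x = X"
      by (simp add: X_def algebra_simps)
    have 2: "x * l - y * \<mu>\<^sub>2 * m\<^sub>1 + z * (m\<^sub>1 * m\<^sub>2) - a\<^sub>2 * x = X * (\<mu>\<^sub>1 + a\<^sub>1) + Y * m\<^sub>1"
    proof -
      have l: "l = m\<^sub>1 * p + (\<mu>\<^sub>1\<^sup>2 + a\<^sub>1 * \<mu>\<^sub>1 + a\<^sub>2)"
        using p by simp
      show ?thesis
        unfolding X_def Y_def l by (simp add: algebra_simps power2_eq_square)
    qed
    have 3: "- a\<^sub>3 * x = X * l - Y * \<mu>\<^sub>2 * m\<^sub>1 + Z * (m\<^sub>1 * m\<^sub>2)"
    proof -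
      have "X * l - Y * \<mu>\<^sub>2 * m\<^sub>1 + Z * (m\<^sub>1 * m\<^sub>2) =
          x * (\<mu>\<^sub>1 * l - \<mu>\<^sub>2 * (m\<^sub>1 * p) - m\<^sub>1 * m\<^sub>2 * q) +
          y * m\<^sub>1 * (l + \<mu>\<^sub>2 * (\<mu>\<^sub>1 + \<mu>\<^sub>2 + a\<^sub>1) - m\<^sub>2 * s)"
        unfolding X_def Y_def Z_def by (simp add: algebra_simps)
      also have "\<dots> = - a\<^sub>3 * x"
        unfolding p[symmetric] q[symmetric] s[symmetric] by (simp add: algebra_simps)
      finally show ?thesis ..
    qed
    show ?thesis
      unfolding u elt_alpha 1 2 3 elt_in_lat_iff by blast
  qed
  moreover have "?L \<subseteq> carrier R"
    unfolding lat_def carrier_R by blast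
  moreover have "0 \<in> ?L"
    using elt_in_lat_iff[of 0 0 0] by (auto simp: elt_def intro!: exI[of _ 0])
  ultimately show "ideal ?L R"
    using lat_diff by (auto simp: ideal_R_iff)
qed

text \<open>Eliminating \<open>l\<close>: the third expression of \<open>ideal_lat_iff\<close> minus
  \<open>\<mu>\<^sub>1 - \<mu>\<^sub>2\<close> times the first is
  \<open>poly F \<mu>\<^sub>1\<close>, and with the second in place of the first it is
  \<open>poly F \<mu>\<^sub>2\<close>.\<close>

lemma ideal_lat_roots:
  assumes "m\<^sub>1 > 0" "m\<^sub>2 > 0" "ideal (lat m\<^sub>1 m\<^sub>2 \<mu>\<^sub>1 \<mu>\<^sub>2 l) R"
  shows "m\<^sub>1 dvd poly F \<mu>\<^sub>1" "m\<^sub>2 dvd poly F \<mu>\<^sub>2"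
proof -
  from assms obtain p q s where
    p: "l - (\<mu>\<^sub>1\<^sup>2 + a\<^sub>1 * \<mu>\<^sub>1 + a\<^sub>2) = m\<^sub>1 * p" and
    s: "l + \<mu>\<^sub>2 * (\<mu>\<^sub>1 + \<mu>\<^sub>2 + a\<^sub>1) = m\<^sub>2 * s" and
    q: "(\<mu>\<^sub>1 - \<mu>\<^sub>2) * l + a\<^sub>3 + \<mu>\<^sub>2 * (\<mu>\<^sub>1\<^sup>2 + a\<^sub>1 * \<mu>\<^sub>1 + a\<^sub>2) = m\<^sub>1 * m\<^sub>2 * q"
    unfolding ideal_lat_iff[OF assms(1,2)] dvd_def by blast
  have "m\<^sub>1 * (m\<^sub>2 * q - (\<mu>\<^sub>1 - \<mu>\<^sub>2) * p) = m\<^sub>1 * m\<^sub>2 * q - (\<mu>\<^sub>1 - \<mu>\<^sub>2) * (m\<^sub>1 * p)"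
    by (simp add: algebra_simps)
  also have "\<dots> = poly F \<mu>\<^sub>1"
    unfolding poly_F p[symmetric] q[symmetric]
    by (simp add: algebra_simps power2_eq_square power3_eq_cube)
  finally have "poly F \<mu>\<^sub>1 = m\<^sub>1 * (m\<^sub>2 * q - (\<mu>\<^sub>1 - \<mu>\<^sub>2) * p)" ..
  then show "m\<^sub>1 dvd poly F \<mu>\<^sub>1" by simp
  have "m\<^sub>2 * (m\<^sub>1 * q - (\<mu>\<^sub>1 - \<mu>\<^sub>2) * s) = m\<^sub>1 * m\<^sub>2 * q - (\<mu>\<^sub>1 - \<mu>\<^sub>2) * (m\<^sub>2 * s)"
    by (simp add: algebra_simps)
  also have "\<dots> = poly F \<mu>\<^sub>2"
    unfolding poly_F s[symmetric] q[symmetric]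
    by (simp add: algebra_simps power2_eq_square power3_eq_cube)
  finally have "poly F \<mu>\<^sub>2 = m\<^sub>2 * (m\<^sub>1 * q - (\<mu>\<^sub>1 - \<mu>\<^sub>2) * s)" ..
  then show "m\<^sub>2 dvd poly F \<mu>\<^sub>2" by simp
qed

section \<open>The discriminant and coprimality\<close>

lemma pderiv_F: "pderiv F = [:a\<^sub>2, 2 * a\<^sub>1, 3:]"
  by (simp add: F_eq pderiv_pCons)

lemma dvd_discriminant:
  assumes "g dvd poly F x" "g dvd poly (pderiv F) x"
  shows "g dvd discriminant F"
proof -
  have "g dvd resultant F (pderiv F)"
    using assms by (rule dvd_resultant) (simp add: F_eq)
  moreover have "lead_coeff F = 1"
    by (simp add: F_eq)
  ultimately show ?thesis
    by (simp add: discriminant_def)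
qed

lemma ideal_lat_coprime:
  assumes "m\<^sub>1 > 0" "m\<^sub>2 > 0" "ideal (lat m\<^sub>1 m\<^sub>2 \<mu>\<^sub>1 \<mu>\<^sub>2 l) R"
    and "Gcd {m\<^sub>1, m\<^sub>2, discriminant F} = 1"
  shows "Gcd {m\<^sub>1, m\<^sub>2, \<mu>\<^sub>1 - \<mu>\<^sub>2} = 1"
proof -
  define g where "g = Gcd {m\<^sub>1, m\<^sub>2, \<mu>\<^sub>1 - \<mu>\<^sub>2}"
  have g: "g dvd m\<^sub>1" "g dvd m\<^sub>2" "g dvd \<mu>\<^sub>1 - \<mu>\<^sub>2"
    unfolding g_def by (rule Gcd_dvd, simp)+
  have "g dvd poly F \<mu>\<^sub>1"
    using g(1) ideal_lat_roots(1)[OF assms(1-3)] by (rule dvd_trans)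
  moreover have "g dvd poly (pderiv F) \<mu>\<^sub>1"
  proof -
    have "g dvd l - (\<mu>\<^sub>1\<^sup>2 + a\<^sub>1 * \<mu>\<^sub>1 + a\<^sub>2)" "g dvd l + \<mu>\<^sub>2 * (\<mu>\<^sub>1 + \<mu>\<^sub>2 + a\<^sub>1)"
      using assms(3) g dvd_trans unfolding ideal_lat_iff[OF assms(1,2)] by blast+
    \<comment> \<open>The two conditions on \<open>l\<close> are subtracted. The last summand, a
      multiple of \<open>\<mu>\<^sub>1 - \<mu>\<^sub>2\<close>, turns the remaining
      \<open>\<mu>\<^sub>2\<close> into \<open>\<mu>\<^sub>1\<close> and produces the derivative
      exactly.\<close>
    then have "g dvd (l + \<mu>\<^sub>2 * (\<mu>\<^sub>1 + \<mu>\<^sub>2 + a\<^sub>1)) - (l - (\<mu>\<^sub>1\<^sup>2 + a\<^sub>1 * \<mu>\<^sub>1 + a\<^sub>2))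
        + (\<mu>\<^sub>1 - \<mu>\<^sub>2) * (2 * \<mu>\<^sub>1 + \<mu>\<^sub>2 + a\<^sub>1)"
      using g(3) by (meson dvd_add dvd_diff dvd_mult2)
    also have "\<dots> = poly (pderiv F) \<mu>\<^sub>1"
      by (simp add: pderiv_F algebra_simps power2_eq_square)
    finally show ?thesis .
  qed
  ultimately have "g dvd discriminant F"
    by (rule dvd_discriminant)
  then have "g dvd Gcd {m\<^sub>1, m\<^sub>2, discriminant F}"
    using g by (intro Gcd_greatest) auto
  then have "is_unit g"
    by (simp only: assms(4))
  then have "normalize g = 1"
    by (rule is_unit_normalize)
  then show ?thesis
    unfolding g_def by (simp only: normalize_Gcd)
qed

section \<open>Uniqueness of the basis up to unipotent matrices\<close>

text \<open>The second and third basis vectors of the smaller lattice are expanded in the basis of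
  the larger one, where their leading zeros force leading coefficients to vanish.\<close>

lemma lat_subset_dvd:
  assumes "lat m\<^sub>1 m\<^sub>2 \<mu>\<^sub>1 \<mu>\<^sub>2 l \<subseteq> lat m\<^sub>1' m\<^sub>2' \<mu>\<^sub>1' \<mu>\<^sub>2' l'" "m\<^sub>1' > 0"
  shows "m\<^sub>1' dvd m\<^sub>1" "m\<^sub>1' * m\<^sub>2' dvd m\<^sub>1 * m\<^sub>2"
proof -
  have "elt 0 m\<^sub>1 (- \<mu>\<^sub>2 * m\<^sub>1) \<in> lat m\<^sub>1 m\<^sub>2 \<mu>\<^sub>1 \<mu>\<^sub>2 l"
    unfolding elt_in_lat_iff by (rule exI[of _ 1], rule exI[of _ 0]) simp
  then have "elt 0 m\<^sub>1 (- \<mu>\<^sub>2 * m\<^sub>1) \<in> lat m\<^sub>1' m\<^sub>2' \<mu>\<^sub>1' \<mu>\<^sub>2' l'"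
    using assms(1) by blast
  then show "m\<^sub>1' dvd m\<^sub>1"
    by (auto simp: elt_in_lat_iff)
  have "elt 0 0 (m\<^sub>1 * m\<^sub>2) \<in> lat m\<^sub>1 m\<^sub>2 \<mu>\<^sub>1 \<mu>\<^sub>2 l"
    unfolding elt_in_lat_iff by (rule exI[of _ 0], rule exI[of _ 1]) simp
  then have "elt 0 0 (m\<^sub>1 * m\<^sub>2) \<in> lat m\<^sub>1' m\<^sub>2' \<mu>\<^sub>1' \<mu>\<^sub>2' l'"
    using assms(1) by blast
  then show "m\<^sub>1' * m\<^sub>2' dvd m\<^sub>1 * m\<^sub>2"
    using assms(2) by (auto simp: elt_in_lat_iff)
qed

lemma lat_eq_imp_unipotent:
  assumes "lat m\<^sub>1 m\<^sub>2 \<mu>\<^sub>1 \<mu>\<^sub>2 l = lat m\<^sub>1' m\<^sub>2' \<mu>\<^sub>1' \<mu>\<^sub>2' l'"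
    and pos: "m\<^sub>1 > 0" "m\<^sub>2 > 0" "m\<^sub>1' > 0" "m\<^sub>2' > 0"
  shows "\<exists>U. upper_unipotent 3 U \<and> basis m\<^sub>1' m\<^sub>2' \<mu>\<^sub>1' \<mu>\<^sub>2' l' = U * basis m\<^sub>1 m\<^sub>2 \<mu>\<^sub>1 \<mu>\<^sub>2 l"
proof -
  note dvd = lat_subset_dvd[OF equalityD1[OF assms(1)] pos(3)]
    lat_subset_dvd[OF equalityD2[OF assms(1)] pos(1)]
  have m1: "m\<^sub>1' = m\<^sub>1"
    using dvd pos by (intro zdvd_antisym_nonneg) auto
  have "m\<^sub>1' * m\<^sub>2' = m\<^sub>1 * m\<^sub>2"
    using dvd pos by (intro zdvd_antisym_nonneg) auto
  then have m2: "m\<^sub>2' = m\<^sub>2"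
    using m1 pos by simp
  have "elt 1 (\<mu>\<^sub>1' + a\<^sub>1) l' \<in> lat m\<^sub>1' m\<^sub>2' \<mu>\<^sub>1' \<mu>\<^sub>2' l'"
    by (auto simp: elt_in_lat_iff intro!: exI[of _ 0])
  then obtain p q where pq: "\<mu>\<^sub>1' + a\<^sub>1 = \<mu>\<^sub>1 + a\<^sub>1 + p * m\<^sub>1"
      "l' = l - p * \<mu>\<^sub>2 * m\<^sub>1 + q * (m\<^sub>1 * m\<^sub>2)"
    unfolding assms(1)[symmetric] elt_in_lat_iff by auto
  have "elt 0 m\<^sub>1' (- \<mu>\<^sub>2' * m\<^sub>1') \<in> lat m\<^sub>1' m\<^sub>2' \<mu>\<^sub>1' \<mu>\<^sub>2' l'"
    unfolding elt_in_lat_iff by (rule exI[of _ 1], rule exI[of _ 0]) simp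
  then obtain p' r where r: "m\<^sub>1' = p' * m\<^sub>1" "- \<mu>\<^sub>2' * m\<^sub>1' = - p' * \<mu>\<^sub>2 * m\<^sub>1 + r * (m\<^sub>1 * m\<^sub>2)"
    unfolding assms(1)[symmetric] elt_in_lat_iff by auto
  have "p' = 1"
    using r(1) m1 pos by simp
  then have "m\<^sub>1 * \<mu>\<^sub>2' = m\<^sub>1 * (\<mu>\<^sub>2 - r * m\<^sub>2)"
    using r(2) m1 by (simp add: algebra_simps)
  then have r: "\<mu>\<^sub>2' = \<mu>\<^sub>2 - r * m\<^sub>2"
    using pos by simp
  \<comment> \<open>The rows are the coordinates of the primed basis vectors in the unprimed basis;
    the ones on the diagonal reflect the equality of the \<open>m\<close>'s.\<close>
  define U :: "int mat" where "U = mat_of_rows_list 3 [[1, p, q], [0, 1, r], [0, 0, 1]]"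
  have "upper_unipotent 3 U"
    by (auto simp: upper_unipotent_def upper_triangular_def U_def mat_of_rows_list_def
        less_Suc_eq numeral_3_eq_3)
  moreover have "basis m\<^sub>1' m\<^sub>2' \<mu>\<^sub>1' \<mu>\<^sub>2' l' = U * basis m\<^sub>1 m\<^sub>2 \<mu>\<^sub>1 \<mu>\<^sub>2 l"
    by (rule eq_matI)
      (use pq r in \<open>auto simp: m1 m2 U_def basis_mat_def mat_of_rows_list_def scalar_prod_def
        less_Suc_eq numeral_3_eq_3 numeral_2_eq_2 algebra_simps\<close>)
  ultimately show ?thesis by blast
qed

section \<open>Hermite normal form of a primitive ideal\<close>

lemma ideal_lat_exists:
  assumes "ideal I R" "I \<noteq> {0}"
    and primitive: "\<not> (\<exists>n::int. n \<ge> 2 \<and> I \<subseteq> (\<lambda>x. of_int n * x) ` carrier R)"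
  obtains m\<^sub>1 m\<^sub>2 \<mu>\<^sub>1 \<mu>\<^sub>2 l where "m\<^sub>1 > 0" "m\<^sub>2 > 0" "I = lat m\<^sub>1 m\<^sub>2 \<mu>\<^sub>1 \<mu>\<^sub>2 l"
proof -
  define P where "P x y z \<longleftrightarrow> elt x y z \<in> I" for x y z
  have sub: "I \<subseteq> carrier R" and P0: "P 0 0 0"
    and diff: "\<And>u v. u \<in> I \<Longrightarrow> v \<in> I \<Longrightarrow> u - v \<in> I" and mult: "\<And>u. u \<in> I \<Longrightarrow> \<alpha> * u \<in> I"
    using assms(1) by (simp_all add: ideal_R_iff P_def elt_def)
  have P_diff: "P (x - x') (y - y') (z - z')" if "P x y z" "P x' y' z'" for x y z x' y' z'
    using diff[of "elt x y z" "elt x' y' z'"] that by (simp add: P_def elt_diff)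
  have P_alpha: "P (y - a\<^sub>1 * x) (z - a\<^sub>2 * x) (- a\<^sub>3 * x)" if "P x y z" for x y z
    using mult[of "elt x y z"] that by (simp add: P_def elt_alpha)
  have P_smult: "P (n * x) (n * y) (n * z)" if "P x y z" for n x y z
  proof -
    interpret ideal I R by (rule assms(1))
    have "elt 0 0 n * elt x y z \<in> I"
      using I_l_closed[of "elt x y z" "elt 0 0 n"] that carrier_R by (auto simp: R_simps P_def)
    then show ?thesis
      by (simp add: P_def elt_smult[symmetric]) (simp add: elt_def)
  qed
  have P_shift: "P (x - n * x') (y - n * y') (z - n * z')" if "P x y z" "P x' y' z'"
    for n x y z x' y' z'
    using that P_diff P_smult by blast

  \<comment> \<open>The integers \<open>d\<close>, \<open>e\<close>, \<open>k\<close> generate the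
    leading coefficients of, respectively, all elements of \<open>I\<close>, those without a square
    term, and the integers in \<open>I\<close>.\<close>
  obtain d where d: "d \<ge> 0" "\<exists>y z. P d y z" "\<And>x y z. P x y z \<Longrightarrow> d dvd x"
    by (rule int_subgroup_generator[of "{x. \<exists>y z. P x y z}"]) (use P0 P_diff in blast)+
  obtain e where e: "e \<ge> 0" "\<exists>z. P 0 e z" "\<And>y z. P 0 y z \<Longrightarrow> e dvd y"
    by (rule int_subgroup_generator[of "{y. \<exists>z. P 0 y z}"])
      (use P0 P_diff[of 0 _ _ 0, simplified] in blast)+
  obtain k where k: "k \<ge> 0" "P 0 0 k" "\<And>z. P 0 0 z \<Longrightarrow> k dvd z"
    by (rule int_subgroup_generator[of "{z. P 0 0 z}"])
      (use P0 P_diff[of 0 0 _ 0 0, simplified] in blast)+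
  obtain g h where gh: "P d g h"
    using d(2) by blast
  obtain f where f: "P 0 e f"
    using e(2) by blast
  obtain c where "c \<noteq> 0" "P 0 0 c"
    using ideal_meets_int[OF assms(1,2)] by (auto simp: P_def elt_def)
  then have "k \<noteq> 0"
    using k(3) by auto
  have "P 0 k 0"
    using P_alpha[OF k(2)] by simp
  then have ek: "e dvd k"
    by (rule e(3))
  have Pef: "P e f 0"
    using P_alpha[OF f] by simp
  then have de: "d dvd e"
    by (rule d(3))
  \<comment> \<open>Multiplication by \<alpha> shifts coordinates to the left, whence
    \<open>d dvd e\<close> and \<open>e dvd k\<close>; the nonzero \<open>k\<close> then makes all
    three nonzero.\<close>
  have pos: "d > 0" "e > 0" "k > 0"
    using d(1) e(1) k(1) \<open>k \<noteq> 0\<close> ek de by (auto simp: order_less_le)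
  have Pgh: "P (g - a\<^sub>1 * d) (h - a\<^sub>2 * d) (- a\<^sub>3 * d)"
    by (rule P_alpha[OF gh])
  obtain e' where e': "e = d * e'"
    using de ..
  \<comment> \<open>Subtracting a multiple of the first row clears the square term of \<alpha> times
    the second row, so \<open>e\<close> divides what is left in the middle.\<close>
  have "P (e - e' * d) (f - e' * g) (0 - e' * h)"
    by (rule P_shift[OF Pef gh])
  then have ef: "e dvd f - e' * g"
    using e(3) e' by (simp add: mult.commute)
  have "d dvd g - a\<^sub>1 * d"
    using Pgh by (rule d(3))
  then have dg: "d dvd g"
    by (simp add: dvd_diff_left_iff)
  then obtain g' where g': "g = d * g'" ..
  have "d dvd f - e' * g"
    using de ef by (rule dvd_trans)
  then have df: "d dvd f"
    using dg by (simp add: dvd_diff_left_iff)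
  \<comment> \<open>The same reduction for \<alpha> times the first row; it shows that
    \<open>d\<close> divides \<open>h\<close> as well.\<close>
  have "P (g - a\<^sub>1 * d - (g' - a\<^sub>1) * d) (h - a\<^sub>2 * d - (g' - a\<^sub>1) * g) (- a\<^sub>3 * d - (g' - a\<^sub>1) * h)"
    by (rule P_shift[OF Pgh gh])
  then have "e dvd h - a\<^sub>2 * d - (g' - a\<^sub>1) * g"
    using e(3) g' by (simp add: algebra_simps)
  with de have "d dvd h - a\<^sub>2 * d - (g' - a\<^sub>1) * g"
    by (rule dvd_trans)
  then have dh: "d dvd h"
    using dg by (simp add: dvd_diff_left_iff)

  have coords: "\<exists>p q r. x = p * d \<and> y = p * g + q * e \<and> z = p * h + q * f + r * k"
    if xyz: "P x y z" for x y z
  proof -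
    obtain p where p: "x = p * d"
      using d(3)[OF xyz] by (auto simp: dvd_def mult.commute)
    have 1: "P 0 (y - p * g) (z - p * h)"
      using P_shift[OF xyz gh, of p] p by simp
    then obtain q where q: "y - p * g = q * e"
      using e(3) by (auto simp: dvd_def mult.commute)
    have "P 0 0 (z - p * h - q * f)"
      using P_shift[OF 1 f, of q] q by simp
    then obtain r where "z - p * h - q * f = r * k"
      using k(3) by (auto simp: dvd_def mult.commute)
    then show ?thesis
      using p q by (intro exI[of _ p] exI[of _ q] exI[of _ r]) simp
  qed

  have "d = 1"
  proof (rule ccontr)
    assume "d \<noteq> 1"
    have "I \<subseteq> (\<lambda>x. of_int d * x) ` carrier R"
    proof
      fix u assume "u \<in> I"
      then obtain x y z where u: "u = elt x y z" "P x y z"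
        using sub unfolding carrier_R P_def by blast
      have "d dvd x \<and> d dvd y \<and> d dvd z"
        using coords[OF u(2)] de df dg dh dvd_trans[OF de ek] by auto
      then obtain x' y' z' where "x = d * x'" "y = d * y'" "z = d * z'"
        by (auto simp: dvd_def)
      then show "u \<in> (\<lambda>x. of_int d * x) ` carrier R"
        using u(1) carrier_R by (auto simp: elt_smult intro!: image_eqI[of _ _ "elt x' y' z'"])
    qed
    then show False
      using primitive pos \<open>d \<noteq> 1\<close> by (auto dest: spec[of _ d])
  qed
  \<comment> \<open>With \<open>d = 1\<close> the factor \<open>e'\<close> equals \<open>e\<close>.
    This divisibility is what allows the second row to be written with entry
    \<open>- \<mu>\<^sub>2 * m\<^sub>1\<close>.\<close>
  have "e dvd f"
    using ef e' \<open>d = 1\<close> by (simp add: dvd_diff_left_iff)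
  then obtain f' where f': "f = e * f'" ..
  obtain m\<^sub>2 where m2: "k = e * m\<^sub>2"
    using ek ..
  have "m\<^sub>2 > 0"
    using m2 pos by (simp add: zero_less_mult_iff)
  moreover have "I = lat e m\<^sub>2 (g - a\<^sub>1) (- f') h"
  proof
    show "I \<subseteq> lat e m\<^sub>2 (g - a\<^sub>1) (- f') h"
    proof
      fix u assume "u \<in> I"
      then obtain x y z where u: "u = elt x y z" "P x y z"
        using sub unfolding carrier_R P_def by blast
      then obtain q r where yz: "y = x * g + q * e" "z = x * h + q * f + r * k"
        using coords[OF u(2)] \<open>d = 1\<close> by auto
      show "u \<in> lat e m\<^sub>2 (g - a\<^sub>1) (- f') h"
        unfolding u(1) elt_in_lat_iff yz f' m2
        by (rule exI[of _ q], rule exI[of _ r]) (simp add: algebra_simps)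
    qed
    show "lat e m\<^sub>2 (g - a\<^sub>1) (- f') h \<subseteq> I"
    proof
      fix u assume "u \<in> lat e m\<^sub>2 (g - a\<^sub>1) (- f') h"
      then obtain x y z where u:
        "u = elt x (x * (g - a\<^sub>1 + a\<^sub>1) + y * e) (x * h - y * (- f') * e + z * (e * m\<^sub>2))"
        unfolding lat_def by blast
      \<comment> \<open>The double negations express a sum of multiples of the three rows through
        \<open>P_shift\<close>, which subtracts.\<close>
      have "P (x * d - (- y) * 0 - (- z) * 0) (x * g - (- y) * e - (- z) * 0)
          (x * h - (- y) * f - (- z) * k)"
        by (intro P_shift P_smult gh f k(2))
      then show "u \<in> I"
        using \<open>d = 1\<close> by (simp add: P_def u f' m2 algebra_simps)
    qed
  qed
  ultimately show ?thesis
    using that pos(2) by blast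
qed

section \<open>The residue class of the last entry in the first row\<close>

lemma ideal_lat_residue:
  assumes pos: "m\<^sub>1 > 0" "m\<^sub>2 > 0"
    and roots: "m\<^sub>1 dvd poly F \<mu>\<^sub>1" "m\<^sub>2 dvd poly F \<mu>\<^sub>2"
    and coprime: "Gcd {m\<^sub>1, m\<^sub>2, \<mu>\<^sub>1 - \<mu>\<^sub>2} = 1"
  shows "\<exists>l\<^sub>0. \<forall>l. ideal (lat m\<^sub>1 m\<^sub>2 \<mu>\<^sub>1 \<mu>\<^sub>2 l) R \<longleftrightarrow> [l = l\<^sub>0] (mod m\<^sub>1 * m\<^sub>2)"
proof -
  define G H \<delta> where "G = \<mu>\<^sub>1\<^sup>2 + a\<^sub>1 * \<mu>\<^sub>1 + a\<^sub>2" and "H = G + \<mu>\<^sub>2 * (\<mu>\<^sub>1 + \<mu>\<^sub>2 + a\<^sub>1)"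
    and "\<delta> = \<mu>\<^sub>1 - \<mu>\<^sub>2"
  obtain K where K: "poly F \<mu>\<^sub>1 = m\<^sub>1 * K"
    using roots(1) ..
  obtain N where N: "poly F \<mu>\<^sub>2 = m\<^sub>2 * N"
    using roots(2) ..
  have dH: "\<delta> * H = m\<^sub>1 * K - m\<^sub>2 * N"
    unfolding K[symmetric] N[symmetric] poly_F H_def G_def \<delta>_def
    by (simp add: algebra_simps power2_eq_square power3_eq_cube)
  have "\<exists>x y z. x * m\<^sub>1 + y * \<delta> + z * m\<^sub>2 = 1"
  proof -
    have "gcd m\<^sub>1 (gcd \<delta> m\<^sub>2) = 1"
      using coprime by (simp add: \<delta>_def gcd.commute)
    then obtain x w where "x * m\<^sub>1 + w * gcd \<delta> m\<^sub>2 = 1"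
      using bezout_int[of m\<^sub>1 "gcd \<delta> m\<^sub>2"] by auto
    moreover obtain y z where "y * \<delta> + z * m\<^sub>2 = gcd \<delta> m\<^sub>2"
      using bezout_int[of \<delta> m\<^sub>2] by auto
    ultimately have "x * m\<^sub>1 + (w * y) * \<delta> + (w * z) * m\<^sub>2 = 1"
      by (metis add.assoc distrib_left mult.assoc)
    then show ?thesis by blast
  qed
  then obtain x y z where bez: "x * m\<^sub>1 + y * \<delta> + z * m\<^sub>2 = 1" by blast
  \<comment> \<open>Adding \<open>x\<close> times \<open>m\<^sub>1 * q + H\<close> and
    \<open>y\<close> times \<open>\<delta> * q + K\<close> and using the Bezout relation leaves
    \<open>q + x * H + y * K\<close> modulo \<open>m\<^sub>2\<close>, so this is the only
    candidate.\<close>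
  define q\<^sub>0 where "q\<^sub>0 = - (x * H + y * K)"
  \<comment> \<open>The first condition holds by the form of \<open>l\<close>; in the third a common
    factor \<open>m\<^sub>1\<close> cancels, leaving divisibility by
    \<open>m\<^sub>2\<close>.\<close>
  have cond: "ideal (lat m\<^sub>1 m\<^sub>2 \<mu>\<^sub>1 \<mu>\<^sub>2 (G + m\<^sub>1 * q)) R \<longleftrightarrow> m\<^sub>2 dvd m\<^sub>1 * q + H \<and> m\<^sub>2 dvd \<delta> * q + K" for q
  proof -
    have B: "G + m\<^sub>1 * q + \<mu>\<^sub>2 * (\<mu>\<^sub>1 + \<mu>\<^sub>2 + a\<^sub>1) = m\<^sub>1 * q + H"
      by (simp add: H_def)
    have C: "\<delta> * (G + m\<^sub>1 * q) + a\<^sub>3 + \<mu>\<^sub>2 * G = m\<^sub>1 * (\<delta> * q + K)"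
    proof -
      have "m\<^sub>1 * (\<delta> * q + K) = m\<^sub>1 * \<delta> * q + poly F \<mu>\<^sub>1"
        by (simp add: K algebra_simps)
      also have "\<dots> = \<delta> * (G + m\<^sub>1 * q) + a\<^sub>3 + \<mu>\<^sub>2 * G"
        unfolding poly_F G_def \<delta>_def by (simp add: algebra_simps power2_eq_square power3_eq_cube)
      finally show ?thesis ..
    qed
    show ?thesis
      using pos unfolding ideal_lat_iff[OF pos] G_def[symmetric] \<delta>_def[symmetric] B C by simp
  qed
  have uniq: "m\<^sub>2 dvd m\<^sub>1 * q + H \<and> m\<^sub>2 dvd \<delta> * q + K \<longleftrightarrow> m\<^sub>2 dvd q - q\<^sub>0" for q
  proof
    assume "m\<^sub>2 dvd m\<^sub>1 * q + H \<and> m\<^sub>2 dvd \<delta> * q + K"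
    then have "m\<^sub>2 dvd x * (m\<^sub>1 * q + H) + y * (\<delta> * q + K) + m\<^sub>2 * (z * q)"
      by simp
    also have "\<dots> = (x * m\<^sub>1 + y * \<delta> + z * m\<^sub>2) * q + (x * H + y * K)"
      by (simp add: algebra_simps)
    also have "\<dots> = q - q\<^sub>0"
      unfolding bez q\<^sub>0_def by simp
    finally show "m\<^sub>2 dvd q - q\<^sub>0" .
  next
    assume "m\<^sub>2 dvd q - q\<^sub>0"
    then obtain t where t: "q = q\<^sub>0 + m\<^sub>2 * t"
      by (auto simp: dvd_def algebra_simps)
    \<comment> \<open>Writing \<open>H\<close> as the Bezout combination times \<open>H\<close>
      brings in \<open>\<delta> * H\<close>, and \<open>dH\<close> cancels the terms in
      \<open>K\<close>. The second congruence is treated alike with \<open>K\<close>.\<close>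
    have "m\<^sub>1 * q + H = m\<^sub>1 * q + (x * m\<^sub>1 + y * \<delta> + z * m\<^sub>2) * H"
      by (simp add: bez)
    also have "\<dots> = m\<^sub>1 * m\<^sub>2 * t - m\<^sub>1 * (y * K) + y * (\<delta> * H) + m\<^sub>2 * (z * H)"
      by (simp add: t q\<^sub>0_def algebra_simps)
    also have "\<dots> = m\<^sub>2 * (m\<^sub>1 * t - y * N + z * H)"
      unfolding dH by (simp add: algebra_simps)
    finally have 1: "m\<^sub>2 dvd m\<^sub>1 * q + H" by simp
    have "\<delta> * q + K = \<delta> * q + (x * m\<^sub>1 + y * \<delta> + z * m\<^sub>2) * K"
      by (simp add: bez)
    also have "\<dots> = \<delta> * m\<^sub>2 * t - x * (\<delta> * H) + x * (m\<^sub>1 * K) + m\<^sub>2 * (z * K)"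
      by (simp add: t q\<^sub>0_def algebra_simps)
    also have "\<dots> = m\<^sub>2 * (\<delta> * t + x * N + z * K)"
      unfolding dH by (simp add: algebra_simps)
    finally have "m\<^sub>2 dvd \<delta> * q + K" by simp
    with 1 show "m\<^sub>2 dvd m\<^sub>1 * q + H \<and> m\<^sub>2 dvd \<delta> * q + K" ..
  qed
  have "ideal (lat m\<^sub>1 m\<^sub>2 \<mu>\<^sub>1 \<mu>\<^sub>2 l) R \<longleftrightarrow> [l = G + m\<^sub>1 * q\<^sub>0] (mod m\<^sub>1 * m\<^sub>2)" for l
  proof (cases "m\<^sub>1 dvd l - G")
    case True
    then obtain q where q: "l = G + m\<^sub>1 * q"
      by (auto simp: dvd_def algebra_simps)
    have "l - (G + m\<^sub>1 * q\<^sub>0) = m\<^sub>1 * (q - q\<^sub>0)"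
      by (simp add: q algebra_simps)
    then show ?thesis
      using pos unfolding q cond uniq cong_iff_dvd_diff by simp
  next
    \<comment> \<open>Here both sides fail: each of them would force \<open>l\<close> to be
      congruent to \<open>G\<close> modulo \<open>m\<^sub>1\<close>.\<close>
    case False
    then have "\<not> ideal (lat m\<^sub>1 m\<^sub>2 \<mu>\<^sub>1 \<mu>\<^sub>2 l) R"
      unfolding ideal_lat_iff[OF pos] G_def[symmetric] by blast
    moreover have "\<not> m\<^sub>1 * m\<^sub>2 dvd l - (G + m\<^sub>1 * q\<^sub>0)"
    proof
      assume "m\<^sub>1 * m\<^sub>2 dvd l - (G + m\<^sub>1 * q\<^sub>0)"
      then have "m\<^sub>1 dvd l - G - m\<^sub>1 * q\<^sub>0"
        by (metis diff_diff_eq dvd_mult_left)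
      then show False
        using False by (simp add: dvd_diff_left_iff)
    qed
    ultimately show ?thesis
      by (simp add: cong_iff_dvd_diff)
  qed
  then show ?thesis by blast
qed

end

theorem theorem2:
  fixes a\<^sub>1 a\<^sub>2 a\<^sub>3 D :: int and F :: "int poly" and \<alpha> :: "'a::field_char_0"
  assumes F: "F = [:a\<^sub>3, a\<^sub>2, a\<^sub>1, 1:]"
    and irred: "irreducible F"
    and root: "poly (of_int_poly F) \<alpha> = 0"
    and D: "D = discriminant F"
  shows
    "(\<forall>I. ideal I (int_adjoin \<alpha>) \<and> I \<noteq> {0} \<and>
          \<not> (\<exists>n::int. n \<ge> 2 \<and> I \<subseteq> (\<lambda>x. of_int n * x) ` carrier (int_adjoin \<alpha>)) \<longrightarrow>
        (\<exists>m\<^sub>1 m\<^sub>2 \<mu>\<^sub>1 \<mu>\<^sub>2 l. m\<^sub>1 > 0 \<and> m\<^sub>2 > 0 \<and>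
           [poly F \<mu>\<^sub>1 = 0] (mod m\<^sub>1) \<and> [poly F \<mu>\<^sub>2 = 0] (mod m\<^sub>2) \<and>
           is_int_basis (basis_vec \<alpha> (basis_mat a\<^sub>1 m\<^sub>1 m\<^sub>2 \<mu>\<^sub>1 \<mu>\<^sub>2 l)) I) \<and>
        (\<forall>m\<^sub>1 m\<^sub>2 \<mu>\<^sub>1 \<mu>\<^sub>2 l. m\<^sub>1 > 0 \<and> m\<^sub>2 > 0 \<and>
           [poly F \<mu>\<^sub>1 = 0] (mod m\<^sub>1) \<and> [poly F \<mu>\<^sub>2 = 0] (mod m\<^sub>2) \<and>
           is_int_basis (basis_vec \<alpha> (basis_mat a\<^sub>1 m\<^sub>1 m\<^sub>2 \<mu>\<^sub>1 \<mu>\<^sub>2 l)) I \<and>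
           Gcd {m\<^sub>1, m\<^sub>2, D} = 1 \<longrightarrow>
           Gcd {m\<^sub>1, m\<^sub>2, \<mu>\<^sub>1 - \<mu>\<^sub>2} = 1 \<and>
           (\<forall>m\<^sub>1' m\<^sub>2' \<mu>\<^sub>1' \<mu>\<^sub>2' l'. m\<^sub>1' > 0 \<and> m\<^sub>2' > 0 \<and>
              [poly F \<mu>\<^sub>1' = 0] (mod m\<^sub>1') \<and> [poly F \<mu>\<^sub>2' = 0] (mod m\<^sub>2') \<and>
              is_int_basis (basis_vec \<alpha> (basis_mat a\<^sub>1 m\<^sub>1' m\<^sub>2' \<mu>\<^sub>1' \<mu>\<^sub>2' l')) I \<longrightarrow>
              (\<exists>U. upper_unipotent 3 U \<and>
                 basis_mat a\<^sub>1 m\<^sub>1' m\<^sub>2' \<mu>\<^sub>1' \<mu>\<^sub>2' l' =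
                   U * basis_mat a\<^sub>1 m\<^sub>1 m\<^sub>2 \<mu>\<^sub>1 \<mu>\<^sub>2 l)))) \<and>
     (\<forall>m\<^sub>1 m\<^sub>2 \<mu>\<^sub>1 \<mu>\<^sub>2. m\<^sub>1 > 0 \<and> m\<^sub>2 > 0 \<and>
        [poly F \<mu>\<^sub>1 = 0] (mod m\<^sub>1) \<and> [poly F \<mu>\<^sub>2 = 0] (mod m\<^sub>2) \<and>
        Gcd {m\<^sub>1, m\<^sub>2, \<mu>\<^sub>1 - \<mu>\<^sub>2} = 1 \<longrightarrow>
        (\<exists>l\<^sub>0. \<forall>l.
           (\<exists>I. is_int_basis (basis_vec \<alpha> (basis_mat a\<^sub>1 m\<^sub>1 m\<^sub>2 \<mu>\<^sub>1 \<mu>\<^sub>2 l)) I \<and>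
                ideal I (int_adjoin \<alpha>)) \<longleftrightarrow> [l = l\<^sub>0] (mod m\<^sub>1 * m\<^sub>2)))"
proof -
  interpret cubic_root a\<^sub>1 a\<^sub>2 a\<^sub>3 F \<alpha>
    by unfold_locales (fact F irred root)+
  show ?thesis
  proof (intro conjI allI impI, goal_cases)
    case (1 I)
    then obtain m\<^sub>1 m\<^sub>2 \<mu>\<^sub>1 \<mu>\<^sub>2 l where lat: "m\<^sub>1 > 0" "m\<^sub>2 > 0" "I = lat m\<^sub>1 m\<^sub>2 \<mu>\<^sub>1 \<mu>\<^sub>2 l"
      using ideal_lat_exists[of I] by metis
    then have "m\<^sub>1 dvd poly F \<mu>\<^sub>1" "m\<^sub>2 dvd poly F \<mu>\<^sub>2"
      using 1 ideal_lat_roots by blast+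
    then show ?case
      using lat is_int_basis_iff[OF lat(1,2)] by (metis cong_0_iff)
  next
    case (2 I m\<^sub>1 m\<^sub>2 \<mu>\<^sub>1 \<mu>\<^sub>2 l)
    then show ?case
      using ideal_lat_coprime[of m\<^sub>1 m\<^sub>2 \<mu>\<^sub>1 \<mu>\<^sub>2 l] is_int_basis_iff[of m\<^sub>1 m\<^sub>2 \<mu>\<^sub>1 \<mu>\<^sub>2 l I] D by metis
  next
    case (3 I m\<^sub>1 m\<^sub>2 \<mu>\<^sub>1 \<mu>\<^sub>2 l m\<^sub>1' m\<^sub>2' \<mu>\<^sub>1' \<mu>\<^sub>2' l')
    then show ?case
      using is_int_basis_iff[of m\<^sub>1 m\<^sub>2 \<mu>\<^sub>1 \<mu>\<^sub>2 l I] is_int_basis_iff[of m\<^sub>1' m\<^sub>2' \<mu>\<^sub>1' \<mu>\<^sub>2' l' I]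
      by (intro lat_eq_imp_unipotent) auto
  next
    case (4 m\<^sub>1 m\<^sub>2 \<mu>\<^sub>1 \<mu>\<^sub>2)
    then have pos: "m\<^sub>1 > 0" "m\<^sub>2 > 0" by auto
    show ?case
      \<comment> \<open>The quantified \<open>I\<close> can only be the lattice itself, so the claim
        becomes a condition on \<open>l\<close> alone.\<close>
      unfolding is_int_basis_iff[OF pos]
      using ideal_lat_residue[OF pos, of \<mu>\<^sub>1 \<mu>\<^sub>2] 4 by (simp add: cong_0_iff)
  qed
qed

end
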